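(* Let $1\leq p\leq q<\infty$, let $\Lambda=\{\lambda_j\}$ and $\Gamma=\{\gamma_j\}$ be Waterman sequences, and let $h_1,h_2$ be nondecreasing sequences of positive reals. Suppose that at least one of the sequences $\Big\{\Gamma(n)^{\frac1{q}}/\Lambda(n)^{\frac1{p}}\Big\}_n$ and $\Big\{h_2(n)^{\frac1{q}}/h_1(n)^{\frac1{p}}\Big\}_n$ is nondecreasing. If $$\sup_{1\leq n<\infty}\left(\frac{\Gamma(n)}{h_2(n)}\right)^{\frac1{q}}\left(\frac{h_1(n)}{\Lambda(n)}\right)^{\frac1{p}}<\infty,$$ then $\Lambda V[h_1]^{(p)}\subseteq\Gamma V[h_2]^{(q)}$.
   Context: All functions are real-valued on a fixed compact interval $[a,b]$. For a subinterval $I$ of $[a,b]$, $f(I)=f(\sup I)-f(\inf I)$. Waterman sequence: a nondecreasing sequence $\Lambda=\{\lambda_j\}_{j=1}^\infty$ of positive numbers with $\sum_{j=1}^\infty\frac1{\lambda_j}=\infty$. For Waterman sequences $\Lambda=\{\lambda_j\}$, $\Gamma=\{\gamma_j\}$, $\Lambda(n)=\sum_{j=1}^n\frac1{\lambda_j}$ and $\Gamma(n)=\sum_{j=1}^n\frac1{\gamma_j}$. For a Waterman sequence $\Lambda$, $1\le p<\infty$ and a nondecreasing sequence $h$ of positive reals, let $v(n;\Lambda,p,f)$ be the supremum of the sums $\sum_{j=1}^n\frac{|f(I_j)|^p}{\lambda_j}$ over all finite collections $\{I_j\}_{j=1}^n$ of nonoverlapping subintervals of $[a,b]$. The class $\Lambda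 V[h]^{(p)}$ consists of all $f$ on $[a,b]$ with $\sup_{n\ge1}\frac{v(n;\Lambda,p,f)}{h(n)}<\infty$. *)

theory Defs
  imports "HOL-Analysis.Analysis"
begin

(* Sequences are indexed from 1: a sequence is a function on nat whose value at 0 is
   never used. *)

definition pos_nondecreasing :: "(nat \<Rightarrow> real) \<Rightarrow> bool" where
  "pos_nondecreasing s \<longleftrightarrow> (\<forall>n\<ge>1. 0 < s n) \<and> mono_on {1..} s"

definition recip_sum :: "(nat \<Rightarrow> real) \<Rightarrow> nat \<Rightarrow> real" where
  "recip_sum L n = (\<Sum>j = 1..n. 1 / L j)"

definition Waterman_seq :: "(nat \<Rightarrow> real) \<Rightarrow> bool" where
  "Waterman_seq L \<longleftrightarrow> pos_nondecreasing L \<and> filterlim (recip_sum L) at_top sequentially"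

definition increment :: "(real \<Rightarrow> real) \<Rightarrow> real set \<Rightarrow> real" where
  "increment f J = f (Sup J) - f (Inf J)"

(* Subintervals are nonempty and may be open, closed, half-open or a single point (whose
   increment is 0).  Only the values I 1, ..., I n of the family I matter. *)
definition nonoverlapping_subintervals :: "real \<Rightarrow> real \<Rightarrow> nat \<Rightarrow> (nat \<Rightarrow> real set) \<Rightarrow> bool" where
  "nonoverlapping_subintervals a b n I \<longleftrightarrow>
     (\<forall>j\<in>{1..n}. is_interval (I j) \<and> I j \<noteq> {} \<and> I j \<subseteq> {a..b}) \<and>
     disjoint_family_on (\<lambda>j. interior (I j)) {1..n}"

(* v(n; Lambda, p, f) on [a,b]; it may be infinite. *)
definition variation_modulus ::
    "real \<Rightarrow> real \<Rightarrow> nat \<Rightarrow> (nat \<Rightarrow> real) \<Rightarrow> real \<Rightarrow> (real \<Rightarrow> real) \<Rightarrow> ereal" where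
  "variation_modulus a b n L p f =
     (SUP I \<in> {I. nonoverlapping_subintervals a b n I}.
        ereal (\<Sum>j = 1..n. \<bar>increment f (I j)\<bar> powr p / L j))"

(* The class Lambda V[h]^(p) on [a,b].  A function on [a,b] is represented by a total
   function; membership depends only on its restriction to [a,b]. *)
definition LambdaV ::
    "real \<Rightarrow> real \<Rightarrow> (nat \<Rightarrow> real) \<Rightarrow> (nat \<Rightarrow> real) \<Rightarrow> real \<Rightarrow> (real \<Rightarrow> real) set" where
  "LambdaV a b L h p =
     {f. (SUP n \<in> {1..}. variation_modulus a b n L p f / ereal (h n)) < \<infinity>}"

end

theory Submission imports Defs begin

text \<open>
  Fix \<open>n\<close> and a nonoverlapping family \<open>I\<close>, and let \<open>x j = \<bar>f (I j)\<bar>\<close>. Two observations reduce the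
  inclusion to a statement about finite sequences. Since \<open>1 / \<gamma> j\<close> decreases, renumbering the
  intervals so that \<open>x\<close> decreases can only enlarge \<open>\<Sum> x j ^ q / \<gamma> j\<close>; and the renumbered family
  competes in \<open>v(n; \<Lambda>, p, f)\<close>, so its sum \<open>\<Sum> x j ^ p / \<lambda> j\<close> is at most \<open>C * h1 n\<close>.

  What remains is an embedding of weighted \<open>l^p\<close> into weighted \<open>l^q\<close> on decreasing sequences. With
  \<open>r = q / p \<ge> 1\<close> and \<open>y = x ^ p\<close>, if \<open>\<Gamma>(k) \<le> A * \<Lambda>(k) ^ r\<close> for all \<open>k \<le> n\<close>, then
  \<open>\<Sum> y j ^ r / \<gamma> j \<le> A * (\<Sum> y j / \<lambda> j) ^ r\<close>
  (\<open>weighted_power_embedding\<close>). Summation by parts replaces the weights \<open>1 / \<gamma> j\<close> by the increments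
  of \<open>A * \<Lambda> ^ r\<close>, and those are compared with the increments of
  \<open>(\<Sum>i\<le>j. y i / \<lambda> i) ^ r\<close> by convexity of the power function.

  Either of the two monotonicity hypotheses, combined with the supremum condition, gives
  \<open>\<Gamma>(k) ^ (1/q) / \<Lambda>(k) ^ (1/p) \<le> M * h2(n) ^ (1/q) / h1(n) ^ (1/p)\<close> for \<open>k \<le> n\<close>: the monotone
  quotient is the one in which \<open>k\<close> is moved up to \<open>n\<close>. Hence \<open>A = M ^ q * h2(n) / h1(n) ^ r\<close> is
  admissible, and the resulting bound is \<open>M ^ q * C ^ r * h2(n)\<close>.
\<close>

section \<open>Decreasing sequences and partial sums\<close>

text \<open>Summation by parts: \<open>\<Sum> c j * (v j - u j)\<close> is a combination of the nonnegative partial sums of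
  \<open>v - u\<close> whose coefficients are the decrements of \<open>c\<close> and its last value, all nonnegative. It
  serves the rearrangement with \<open>c = 1 / \<gamma>\<close> and the change of weights with \<open>c = y ^ r\<close>.\<close>

lemma sum_mult_le_of_partial_sums_le:
  fixes c u v :: "nat \<Rightarrow> real"
  assumes anti: "antimono_on {1..n} c" and nonneg: "\<And>j. j \<in> {1..n} \<Longrightarrow> 0 \<le> c j"
    and partial: "\<And>k. k \<in> {1..n} \<Longrightarrow> (\<Sum>j=1..k. u j) \<le> (\<Sum>j=1..k. v j)"
  shows "(\<Sum>j=1..n. c j * u j) \<le> (\<Sum>j=1..n. c j * v j)"
proof (cases "n = 0")
  case False
  define d where "d j = v j - u j" for j
  have d: "0 \<le> (\<Sum>j=1..k. d j)" if "k \<in> {1..n}" for k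
    using partial[OF that] by (simp add: d_def sum_subtractf)
  have "m \<le> n \<longrightarrow> c m * (\<Sum>j=1..m. d j) \<le> (\<Sum>j=1..m. c j * d j)" if "1 \<le> m" for m
    using that
  proof (induction m rule: nat_induct_at_least)
    case base
    show ?case by simp
  next
    case (Suc m)
    show ?case
    proof
      assume le: "Suc m \<le> n"
      have "c (Suc m) \<le> c m"
        using monotone_onD[OF anti, of m "Suc m"] Suc.hyps le by simp
      moreover have "0 \<le> (\<Sum>j=1..m. d j)"
        using d Suc.hyps le by simp
      ultimately have "c (Suc m) * (\<Sum>j=1..m. d j) \<le> c m * (\<Sum>j=1..m. d j)"
        by (rule mult_right_mono)
      then show "c (Suc m) * (\<Sum>j=1..Suc m. d j) \<le> (\<Sum>j=1..Suc m. c j * d j)"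
        using Suc.IH le by (simp add: distrib_left)
    qed
  qed
  from this[of n] have "c n * (\<Sum>j=1..n. d j) \<le> (\<Sum>j=1..n. c j * d j)"
    using False by simp
  moreover have "0 \<le> c n * (\<Sum>j=1..n. d j)"
    using nonneg[of n] d[of n] False by simp
  ultimately show ?thesis
    by (simp add: d_def right_diff_distrib sum_subtractf)
qed simp

text \<open>Exchanging the elements of \<open>T\<close> beyond \<open>k\<close> for the same number of missing indices up to \<open>k\<close>
  replaces values at most \<open>z k\<close> by values at least \<open>z k\<close>.\<close>

lemma sum_le_initial_sum_of_antimono:
  fixes z :: "nat \<Rightarrow> real"
  assumes anti: "antimono_on {1..n} z" and k: "k \<in> {1..n}"
    and T: "T \<subseteq> {1..n}" "card T = k"
  shows "(\<Sum>j\<in>T. z j) \<le> (\<Sum>j=1..k. z j)"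
proof -
  have fin: "finite T" using T(1) finite_subset by blast
  have "card (T \<inter> {1..k}) + card (T - {1..k}) = card ({1..k} \<inter> T) + card ({1..k} - T)"
    using fin T(2) by (simp flip: card_Int_Diff)
  then have card: "card (T - {1..k}) = card ({1..k} - T)"
    by (simp add: Int_commute)
  have "(\<Sum>j\<in>T - {1..k}. z j) \<le> of_nat (card (T - {1..k})) * z k"
  proof (rule sum_bounded_above)
    fix j assume "j \<in> T - {1..k}"
    then have "j \<in> {1..n}" "k \<le> j" using T(1) by auto
    then show "z j \<le> z k" using monotone_onD[OF anti k] by simp
  qed
  also have "\<dots> = of_nat (card ({1..k} - T)) * z k" by (simp only: card)
  also have "\<dots> \<le> (\<Sum>j\<in>{1..k} - T. z j)"
  proof (rule sum_bounded_below)
    fix j assume "j \<in> {1..k} - T"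
    then have "j \<in> {1..n}" "j \<le> k" using k by auto
    then show "z k \<le> z j" using monotone_onD[OF anti _ k] by simp
  qed
  finally have "(\<Sum>j\<in>T - {1..k}. z j) \<le> (\<Sum>j\<in>{1..k} - T. z j)" .
  moreover have "(\<Sum>j\<in>T. z j) = (\<Sum>j\<in>T \<inter> {1..k}. z j) + (\<Sum>j\<in>T - {1..k}. z j)"
    using fin by (rule sum.Int_Diff)
  moreover have "(\<Sum>j=1..k. z j) = (\<Sum>j\<in>{1..k} \<inter> T. z j) + (\<Sum>j\<in>{1..k} - T. z j)"
    by (rule sum.Int_Diff) simp
  ultimately show ?thesis by (simp add: Int_commute)
qed

lemma exists_antimono_rearrangement:
  fixes x :: "nat \<Rightarrow> real"
  shows "\<exists>\<sigma>. bij_betw \<sigma> {1..n} {1..n} \<and> antimono_on {1..n} (x \<circ> \<sigma>)"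
proof -
  define xs where "xs = sort_key (\<lambda>i. - x i) [1..<Suc n]"
  have len: "length xs = n" and set: "set xs = {1..n}" and dist: "distinct xs"
    by (auto simp: xs_def)
  have sorted: "sorted (map (\<lambda>i. - x i) xs)"
    unfolding xs_def by (rule sorted_sort_key)
  have nth: "bij_betw (\<lambda>i. xs ! i) {..<n} {1..n}"
    using bij_betw_nth[OF dist, of "{..<n}" "{1..n}"] len set by simp
  have shift: "bij_betw (\<lambda>j. j - 1) {1..n} {..<n}"
    by (rule bij_betw_byWitness[where f' = Suc]) auto
  have "bij_betw ((\<lambda>i. xs ! i) \<circ> (\<lambda>j. j - 1)) {1..n} {1..n}"
    by (rule bij_betw_trans[OF shift nth])
  moreover have "antimono_on {1..n} (x \<circ> ((\<lambda>i. xs ! i) \<circ> (\<lambda>j. j - 1)))"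
  proof (rule monotone_onI)
    fix i j assume "i \<in> {1..n}" "j \<in> {1..n}" "i \<le> j"
    then have "i - 1 \<le> j - 1" "j - 1 < length xs" using len by auto
    from sorted_nth_mono[OF sorted this(1)] this
    show "(x \<circ> ((\<lambda>i. xs ! i) \<circ> (\<lambda>j. j - 1))) i \<ge> (x \<circ> ((\<lambda>i. xs ! i) \<circ> (\<lambda>j. j - 1))) j"
      by simp
  qed
  ultimately show ?thesis by blast
qed

text \<open>The first \<open>k\<close> terms of the rearrangement are the \<open>k\<close> largest values of \<open>z\<close>, so each of its
  partial sums dominates the one of \<open>z\<close>; decreasing weights preserve this.\<close>

lemma sum_mult_le_antimono_rearrangement:
  fixes c z :: "nat \<Rightarrow> real"
  assumes "antimono_on {1..n} c" and "\<And>j. j \<in> {1..n} \<Longrightarrow> 0 \<le> c j"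
    and bij: "bij_betw \<sigma> {1..n} {1..n}" and anti: "antimono_on {1..n} (z \<circ> \<sigma>)"
  shows "(\<Sum>j=1..n. c j * z j) \<le> (\<Sum>j=1..n. c j * z (\<sigma> j))"
proof (rule sum_mult_le_of_partial_sums_le)
  fix k assume k: "k \<in> {1..n}"
  define \<tau> where "\<tau> = inv_into {1..n} \<sigma>"
  have \<tau>: "bij_betw \<tau> {1..n} {1..n}"
    unfolding \<tau>_def by (rule bij_betw_inv_into[OF bij])
  have sub: "{1..k} \<subseteq> {1..n}" using k by auto
  have inj: "inj_on \<tau> {1..k}"
    using \<tau> sub by (meson bij_betw_imp_inj_on inj_on_subset)
  have "(\<Sum>j=1..k. z j) = (\<Sum>j=1..k. (z \<circ> \<sigma>) (\<tau> j))"
    using bij sub by (intro sum.cong) (auto simp: \<tau>_def bij_betw_inv_into_right)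
  also have "\<dots> = (\<Sum>j\<in>\<tau> ` {1..k}. (z \<circ> \<sigma>) j)"
    using sum.reindex[OF inj, of "z \<circ> \<sigma>"] by (simp add: o_def)
  also have "\<dots> \<le> (\<Sum>j=1..k. (z \<circ> \<sigma>) j)"
  proof (rule sum_le_initial_sum_of_antimono[OF anti k])
    show "\<tau> ` {1..k} \<subseteq> {1..n}"
      using \<tau> sub by (metis bij_betw_imp_surj_on image_mono)
    show "card (\<tau> ` {1..k}) = k" using card_image[OF inj] by simp
  qed
  finally show "(\<Sum>j=1..k. z j) \<le> (\<Sum>j=1..k. z (\<sigma> j))" by simp
qed (use assms in auto)

section \<open>Weighted power sums of decreasing sequences\<close>

text \<open>Convexity of the power function: an increment over a step of fixed length \<open>d\<close> grows with its
  starting point.\<close>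

lemma powr_increment_mono:
  fixes r s t d :: real
  assumes r: "1 \<le> r" and s: "0 < s" "s \<le> t" and d: "0 \<le> d"
  shows "(s + d) powr r - s powr r \<le> (t + d) powr r - t powr r"
proof (rule DERIV_nonneg_imp_nondecreasing[OF s(2)])
  fix x assume "s \<le> x" "x \<le> t"
  then have x: "0 < x" using s(1) by linarith
  have "((\<lambda>x. (x + d) powr r - x powr r) has_real_derivative
      r * (x + d) powr (r - 1) - r * x powr (r - 1)) (at x)"
    using x d by (auto intro!: derivative_eq_intros)
  moreover have "x powr (r - 1) \<le> (x + d) powr (r - 1)"
    using x d r by (intro powr_mono2) auto
  then have "0 \<le> r * (x + d) powr (r - 1) - r * x powr (r - 1)"
    using r by (simp add: mult_left_mono)
  ultimately show "\<exists>D. ((\<lambda>x. (x + d) powr r - x powr r) has_real_derivative D) (at x) \<and> 0 \<le> D"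
    by blast
qed

lemma recip_sum_0 [simp]: "recip_sum L 0 = 0"
  by (simp add: recip_sum_def)

lemma recip_sum_Suc [simp]: "recip_sum L (Suc n) = recip_sum L n + 1 / L (Suc n)"
  by (simp add: recip_sum_def)

lemma recip_sum_pos:
  assumes "\<And>j. j \<in> {1..k} \<Longrightarrow> 0 < L j" "1 \<le> k"
  shows "0 < recip_sum L k"
  unfolding recip_sum_def using assms by (intro sum_pos) auto

text \<open>Both sides are sums of increments, so it suffices to compare the \<open>(m+1)\<close>-st. With
  \<open>S = \<Sum>i\<le>m. y i / \<lambda> i\<close>, the right one is that of the \<open>r\<close>-th power from \<open>S\<close> over the step
  \<open>y (m+1) / \<lambda> (m+1)\<close>, the left one has the same step but starts at \<open>y (m+1) * \<Lambda>(m)\<close>, which is at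
  most \<open>S\<close> because \<open>y\<close> decreases.\<close>

lemma sum_powr_increments_le:
  fixes y L :: "nat \<Rightarrow> real"
  assumes r: "1 \<le> r" and L: "\<And>j. j \<in> {1..n} \<Longrightarrow> 0 < L j"
    and anti: "antimono_on {1..n} y" and nonneg: "\<And>j. j \<in> {1..n} \<Longrightarrow> 0 \<le> y j"
  shows "(\<Sum>j=1..n. y j powr r * (recip_sum L j powr r - recip_sum L (j - 1) powr r))
    \<le> (\<Sum>j=1..n. y j / L j) powr r"
  using L anti nonneg
proof (induction n)
  case 0
  show ?case by simp
next
  case (Suc m)
  define S where "S = (\<Sum>j=1..m. y j / L j)"
  let ?y = "y (Suc m)" and ?l = "1 / L (Suc m)"
  have "antimono_on {1..m} y"
    using Suc.prems(2) by (rule monotone_on_subset) auto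
  then have IH: "(\<Sum>j=1..m. y j powr r * (recip_sum L j powr r - recip_sum L (j - 1) powr r)) \<le> S powr r"
    unfolding S_def using Suc.prems by (intro Suc.IH) auto
  have y: "0 \<le> ?y" and l: "0 < ?l" using Suc.prems by auto
  have S: "0 \<le> S"
    unfolding S_def using Suc.prems by (intro sum_nonneg) (auto intro!: divide_nonneg_pos)
  have step: "?y powr r * ((recip_sum L m + ?l) powr r - recip_sum L m powr r)
      \<le> (S + ?y * ?l) powr r - S powr r"
    \<comment> \<open>The power function is differentiated at positive points only; both sides agree when the
      starting point \<open>?y * recip_sum L m\<close> vanishes.\<close>
  proof (cases "m = 0 \<or> ?y = 0")
    case True
    then show ?thesis using y l r by (auto simp: S_def simp flip: powr_mult)
  next
    case False
    then have \<Lambda>: "0 < recip_sum L m"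
      using Suc.prems(1) by (intro recip_sum_pos) auto
    have start: "?y * recip_sum L m \<le> S"
      unfolding recip_sum_def S_def sum_distrib_left
    proof (rule sum_mono)
      fix j assume j: "j \<in> {1..m}"
      then have "?y \<le> y j" using monotone_onD[OF Suc.prems(2), of j "Suc m"] by simp
      then show "?y * (1 / L j) \<le> y j / L j"
        using j Suc.prems(1)[of j] by (simp add: divide_right_mono)
    qed
    have "?y powr r * ((recip_sum L m + ?l) powr r - recip_sum L m powr r)
        = (?y * recip_sum L m + ?y * ?l) powr r - (?y * recip_sum L m) powr r"
      using y l \<Lambda> powr_mult[of ?y "recip_sum L m + ?l" r]
      by (simp add: right_diff_distrib powr_mult[of ?y "recip_sum L m"] distrib_left)
    also have "\<dots> \<le> (S + ?y * ?l) powr r - S powr r"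
      using r y l \<Lambda> start False by (intro powr_increment_mono) auto
    finally show ?thesis .
  qed
  show ?case using IH step by (simp add: S_def)
qed

theorem weighted_power_embedding:
  fixes y L G :: "nat \<Rightarrow> real"
  assumes r: "1 \<le> r" and A: "0 \<le> A"
    and L: "\<And>j. j \<in> {1..n} \<Longrightarrow> 0 < L j"
    and anti: "antimono_on {1..n} y" and nonneg: "\<And>j. j \<in> {1..n} \<Longrightarrow> 0 \<le> y j"
    and bound: "\<And>k. k \<in> {1..n} \<Longrightarrow> recip_sum G k \<le> A * recip_sum L k powr r"
  shows "(\<Sum>j=1..n. y j powr r / G j) \<le> A * (\<Sum>j=1..n. y j / L j) powr r"
proof -
  let ?D = "\<lambda>j. recip_sum L j powr r - recip_sum L (j - 1) powr r"
  have telescope: "(\<Sum>j=1..k. A * ?D j) = A * recip_sum L k powr r" for k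
    by (induction k) (simp_all add: right_diff_distrib)
  have "(\<Sum>j=1..n. y j powr r / G j) = (\<Sum>j=1..n. y j powr r * (1 / G j))" by simp
  also have "\<dots> \<le> (\<Sum>j=1..n. y j powr r * (A * ?D j))"
  proof (rule sum_mult_le_of_partial_sums_le)
    show "antimono_on {1..n} (\<lambda>j. y j powr r)"
    proof (rule monotone_onI)
      fix i j assume "i \<in> {1..n}" "j \<in> {1..n}" "i \<le> j"
      then show "y j powr r \<le> y i powr r"
        using r nonneg monotone_onD[OF anti, of i j] by (intro powr_mono2) auto
    qed
    fix k assume "k \<in> {1..n}"
    then show "(\<Sum>j=1..k. 1 / G j) \<le> (\<Sum>j=1..k. A * ?D j)"
      unfolding telescope using bound[of k] by (simp add: recip_sum_def)
  qed simp
  also have "\<dots> = A * (\<Sum>j=1..n. y j powr r * ?D j)"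
    by (simp add: sum_distrib_left mult.left_commute)
  also have "\<dots> \<le> A * (\<Sum>j=1..n. y j / L j) powr r"
    using sum_powr_increments_le[OF r L anti nonneg] A by (intro mult_left_mono) auto
  finally show ?thesis .
qed

section \<open>Membership in the classes\<close>

lemma variation_modulus_le_iff:
  "variation_modulus a b n L p f \<le> ereal B \<longleftrightarrow>
    (\<forall>I. nonoverlapping_subintervals a b n I \<longrightarrow>
      (\<Sum>j=1..n. \<bar>increment f (I j)\<bar> powr p / L j) \<le> B)"
  by (auto simp: variation_modulus_def SUP_le_iff)

lemma SUP_ereal_bounded_iff:
  fixes g :: "'a \<Rightarrow> ereal"
  shows "(SUP n\<in>N. g n) < \<infinity> \<longleftrightarrow> (\<exists>C>0. \<forall>n\<in>N. g n \<le> ereal C)"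
proof
  assume "(SUP n\<in>N. g n) < \<infinity>"
  then obtain m :: nat where m: "(SUP n\<in>N. g n) < ereal (real m)"
    using less_PInf_Ex_of_nat by auto
  have "g n \<le> ereal (real m + 1)" if "n \<in> N" for n
  proof -
    have "g n \<le> (SUP n\<in>N. g n)" using that by (rule SUP_upper)
    also have "\<dots> \<le> ereal (real m + 1)" using m by (rule order.trans[OF less_imp_le]) simp
    finally show ?thesis .
  qed
  then show "\<exists>C>0. \<forall>n\<in>N. g n \<le> ereal C"
    by (intro exI[of _ "real m + 1"]) auto
next
  assume "\<exists>C>0. \<forall>n\<in>N. g n \<le> ereal C"
  then obtain C where "\<forall>n\<in>N. g n \<le> ereal C" by blast
  then have "(SUP n\<in>N. g n) \<le> ereal C" by (intro SUP_least) auto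
  then show "(SUP n\<in>N. g n) < \<infinity>" by (rule order.strict_trans1) simp
qed

lemma LambdaV_iff:
  assumes h: "\<And>n. 1 \<le> n \<Longrightarrow> 0 < h n"
  shows "f \<in> LambdaV a b L h p \<longleftrightarrow>
    (\<exists>C>0. \<forall>n\<ge>1. \<forall>I. nonoverlapping_subintervals a b n I \<longrightarrow>
      (\<Sum>j=1..n. \<bar>increment f (I j)\<bar> powr p / L j) \<le> C * h n)"
proof -
  have "variation_modulus a b n L p f / ereal (h n) \<le> ereal C \<longleftrightarrow>
      variation_modulus a b n L p f \<le> ereal (C * h n)" if "1 \<le> n" for n C
    using h[OF that] by (subst ereal_divide_le_pos) (auto simp: mult.commute)
  then show ?thesis
    unfolding LambdaV_def mem_Collect_eq SUP_ereal_bounded_iff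
    by (simp add: variation_modulus_le_iff Ball_def)
qed

lemma nonoverlapping_subintervals_permute:
  assumes I: "nonoverlapping_subintervals a b n I" and \<sigma>: "bij_betw \<sigma> {1..n} {1..n}"
  shows "nonoverlapping_subintervals a b n (I \<circ> \<sigma>)"
proof -
  have mem: "\<sigma> j \<in> {1..n}" if "j \<in> {1..n}" for j
    using \<sigma> that by (rule bij_betwE[THEN bspec])
  have "disjoint_family_on (\<lambda>j. interior ((I \<circ> \<sigma>) j)) {1..n}"
    unfolding disjoint_family_on_def
  proof (intro ballI impI)
    fix i j assume ij: "i \<in> {1..n}" "j \<in> {1..n}" "i \<noteq> j"
    then have "\<sigma> i \<noteq> \<sigma> j" using \<sigma> by (meson bij_betw_imp_inj_on inj_onD)
    then show "interior ((I \<circ> \<sigma>) i) \<inter> interior ((I \<circ> \<sigma>) j) = {}"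
      using I mem ij(1,2)
      by (auto simp: nonoverlapping_subintervals_def disjoint_family_on_def)
  qed
  then show ?thesis
    using I mem by (auto simp: nonoverlapping_subintervals_def)
qed

theorem theorem2p5:
  fixes a b p q :: real and \<Lambda> \<Gamma> h1 h2 :: "nat \<Rightarrow> real"
  assumes "a \<le> b"
    and "1 \<le> p" and "p \<le> q"
    and "Waterman_seq \<Lambda>" and "Waterman_seq \<Gamma>"
    and "pos_nondecreasing h1" and "pos_nondecreasing h2"
    and "mono_on {1..} (\<lambda>n. recip_sum \<Gamma> n powr (1 / q) / recip_sum \<Lambda> n powr (1 / p)) \<or>
         mono_on {1..} (\<lambda>n. h2 n powr (1 / q) / h1 n powr (1 / p))"
    and "(SUP n \<in> {1..}. ereal ((recip_sum \<Gamma> n / h2 n) powr (1 / q) *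
                                (h1 n / recip_sum \<Lambda> n) powr (1 / p))) < \<infinity>"
  shows "LambdaV a b \<Lambda> h1 p \<subseteq> LambdaV a b \<Gamma> h2 q"
proof
  fix f assume f: "f \<in> LambdaV a b \<Lambda> h1 p"
  define r where "r = q / p"
  have p: "0 < p" and q: "0 < q" and r: "1 \<le> r" and pr: "p * r = q" "1 / p * q = r"
    using assms(2,3) by (auto simp: r_def)
  have pos: "0 < \<Lambda> n" "0 < \<Gamma> n" "0 < h1 n" "0 < h2 n" if "1 \<le> n" for n
    using assms(4-7) that by (auto simp: Waterman_seq_def pos_nondecreasing_def)
  have sum_pos: "0 < recip_sum \<Lambda> n" "0 < recip_sum \<Gamma> n" if "1 \<le> n" for n
    using pos that by (auto intro!: recip_sum_pos)
  define G where "G n = recip_sum \<Gamma> n powr (1 / q) / recip_sum \<Lambda> n powr (1 / p)" for n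
  define H where "H n = h2 n powr (1 / q) / h1 n powr (1 / p)" for n
  have H_pos: "0 < H n" if "1 \<le> n" for n
    using pos[OF that] by (simp add: H_def)
  obtain M where M: "0 < M" and
    sup: "\<And>n. 1 \<le> n \<Longrightarrow> (recip_sum \<Gamma> n / h2 n) powr (1 / q) * (h1 n / recip_sum \<Lambda> n) powr (1 / p) \<le> M"
    using assms(9) unfolding SUP_ereal_bounded_iff by auto
  have GH: "G n \<le> M * H n" if "1 \<le> n" for n
  proof -
    have "(recip_sum \<Gamma> n / h2 n) powr (1 / q) * (h1 n / recip_sum \<Lambda> n) powr (1 / p) = G n / H n"
      using pos[OF that] sum_pos[OF that] by (simp add: G_def H_def powr_divide)
    then show ?thesis
      using sup[OF that] H_pos[OF that] by (simp add: pos_divide_le_eq)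
  qed
  have comparison: "G k \<le> M * H n" if "1 \<le> k" "k \<le> n" for k n
    using assms(8)
  proof
    assume "mono_on {1..} (\<lambda>n. recip_sum \<Gamma> n powr (1 / q) / recip_sum \<Lambda> n powr (1 / p))"
    from mono_onD[OF this, of k n] have "G k \<le> G n" unfolding G_def using that by simp
    then show ?thesis using GH[of n] that by linarith
  next
    assume "mono_on {1..} (\<lambda>n. h2 n powr (1 / q) / h1 n powr (1 / p))"
    from mono_onD[OF this, of k n] have "H k \<le> H n" unfolding H_def using that by simp
    then have "M * H k \<le> M * H n" using M by simp
    then show ?thesis using GH[of k] that by linarith
  qed
  have bound: "recip_sum \<Gamma> k \<le> (M * H n) powr q * recip_sum \<Lambda> k powr r"
    if k: "1 \<le> k" "k \<le> n" for k n
  proof -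
    have "G k powr q \<le> (M * H n) powr q"
      using q comparison[OF k] by (intro powr_mono2) (auto simp: G_def)
    moreover have "G k powr q = recip_sum \<Gamma> k / recip_sum \<Lambda> k powr r"
      using sum_pos[OF k(1)] q pr by (simp add: G_def powr_divide powr_powr)
    ultimately show ?thesis
      using sum_pos[OF k(1)] by (simp add: field_simps)
  qed
  obtain C where C: "0 < C" and
    var: "\<And>n I. 1 \<le> n \<Longrightarrow> nonoverlapping_subintervals a b n I \<Longrightarrow>
      (\<Sum>j=1..n. \<bar>increment f (I j)\<bar> powr p / \<Lambda> j) \<le> C * h1 n"
    using f LambdaV_iff[of h1 f a b \<Lambda> p] pos(3) by blast
  have main: "(\<Sum>j=1..n. \<bar>increment f (I j)\<bar> powr q / \<Gamma> j) \<le> (M powr q * C powr r) * h2 n"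
    if n: "1 \<le> n" and I: "nonoverlapping_subintervals a b n I" for n I
  proof -
    define x where "x j = \<bar>increment f (I j)\<bar>" for j
    obtain \<sigma> where \<sigma>: "bij_betw \<sigma> {1..n} {1..n}" and anti: "antimono_on {1..n} (x \<circ> \<sigma>)"
      using exists_antimono_rearrangement by blast
    have anti_powr: "antimono_on {1..n} (\<lambda>j. x (\<sigma> j) powr s)" if "0 \<le> s" for s
    proof (rule monotone_onI)
      fix i j assume "i \<in> {1..n}" "j \<in> {1..n}" "i \<le> j"
      then show "x (\<sigma> j) powr s \<le> x (\<sigma> i) powr s"
        using that monotone_onD[OF anti, of i j] by (intro powr_mono2) (auto simp: x_def)
    qed
    have "antimono_on {1..n} (\<lambda>j. 1 / \<Gamma> j)"
    proof (rule monotone_onI)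
      fix i j assume ij: "i \<in> {1..n}" "j \<in> {1..n}" "i \<le> j"
      have "mono_on {1..} \<Gamma>"
        using assms(5) by (simp add: Waterman_seq_def pos_nondecreasing_def)
      from mono_onD[OF this, of i j] have "\<Gamma> i \<le> \<Gamma> j" using ij by simp
      then show "1 / \<Gamma> j \<le> 1 / \<Gamma> i"
        using pos(2)[of i] ij by (simp add: frac_le)
    qed
    then have "(\<Sum>j=1..n. 1 / \<Gamma> j * x j powr q) \<le> (\<Sum>j=1..n. 1 / \<Gamma> j * x (\<sigma> j) powr q)"
      using pos(2) \<sigma> anti_powr[of q] q
      by (intro sum_mult_le_antimono_rearrangement[where z = "\<lambda>j. x j powr q"])
        (auto simp: o_def less_imp_le)
    then have "(\<Sum>j=1..n. x j powr q / \<Gamma> j) \<le> (\<Sum>j=1..n. x (\<sigma> j) powr q / \<Gamma> j)"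
      by simp
    also have "\<dots> = (\<Sum>j=1..n. (x (\<sigma> j) powr p) powr r / \<Gamma> j)"
      by (simp add: powr_powr pr)
    also have "\<dots> \<le> (M * H n) powr q * (\<Sum>j=1..n. x (\<sigma> j) powr p / \<Lambda> j) powr r"
      using r pos(1) anti_powr[of p] p bound
      by (intro weighted_power_embedding) auto
    also have "\<dots> \<le> (M * H n) powr q * (C * h1 n) powr r"
    proof (intro mult_left_mono powr_mono2)
      show "(\<Sum>j=1..n. x (\<sigma> j) powr p / \<Lambda> j) \<le> C * h1 n"
        using var[OF n nonoverlapping_subintervals_permute[OF I \<sigma>]] by (simp add: x_def)
      show "0 \<le> (\<Sum>j=1..n. x (\<sigma> j) powr p / \<Lambda> j)"
        using pos(1) by (intro sum_nonneg) (auto simp: less_imp_le)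
    qed (use r in auto)
    also have "\<dots> = (M powr q * C powr r) * h2 n"
    proof -
      have "H n powr q = h2 n / h1 n powr r"
        using pos[OF n] q pr by (simp add: H_def powr_divide powr_powr)
      then show ?thesis
        using M C H_pos[OF n] pos[OF n] by (simp add: powr_mult)
    qed
    finally show ?thesis by (simp add: x_def)
  qed
  have "0 < M powr q * C powr r" using M C by simp
  then show "f \<in> LambdaV a b \<Gamma> h2 q"
    using LambdaV_iff[of h2 f a b \<Gamma> q] pos(4) main by blast
qed

end
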